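(* Let $\mathcal{A}\in\mathbb{C}^{n\times n\times n_3}$ and let $\mathcal{A}=\mathcal{Q}^H*_c\mathcal{T}*_c\mathcal{Q}$ be the C-Schur decomposition of $\mathcal{A}$. Then $$\mathcal{A}^\dagger=\mathcal{Q}^H*_c\mathcal{T}^\dagger*_c\mathcal{Q}.$$
   Context: For a third-order tensor $\mathcal{A}\in\mathbb{C}^{n_1\times n_2\times n_3}$, $\mathcal{A}^{(i)}=\mathcal{A}(:,:,i)\in\mathbb{C}^{n_1\times n_2}$ denotes its $i$-th frontal slice. Let $\mathbf{C}_{n_3}$ be the $n_3\times n_3$ orthogonal DCT matrix, with entries $(\mathbf{C}_{n_3})_{jk}=\sqrt{(2-\delta_{j1})/n_3}\,\cos\big(\tfrac{(j-1)(2k-1)\pi}{2n_3}\big)$; let $\mathbf{W}$ be the diagonal matrix whose diagonal is the first column of $\mathbf{C}_{n_3}$; let $\mathbf{Z}$ be the $n_3\times n_3$ matrix with ones on the first superdiagonal and zeros elsewhere; and put $\mathbf{M}=\mathbf{W}^{-1}\mathbf{C}_{n_3}(\mathbf{I}+\mathbf{Z})$, an invertible matrix. Define the linear bijection $L$ on tensors with third dimension $n_3$ by $L(\mathcal{A})_{ijk}=\sum_{l=1}^{n_3}\mathbf{M}_{kl}\mathcal{A}_{ijl}$. The C-product of $\mathcal{A}\in\mathbb{C}^{n_1\times n_2\times n_3}$ and $\mathcal{B}\in\mathbb{C}^{n_2\times l\times n_3}$ is the tensor $\mathcal{A}*_c\mathcal{B}\in\mathbb{C}^{n_1\times l\times n_3}$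 determined by $L(\mathcal{A}*_c\mathcal{B})^{(i)}=L(\mathcal{A})^{(i)}L(\mathcal{B})^{(i)}$, $i=1,\dots,n_3$. The conjugate transpose $\mathcal{A}^H$ is determined by $L(\mathcal{A}^H)^{(i)}=(L(\mathcal{A})^{(i)})^H$ for all $i$. The identity tensor $\mathcal{I}\in\mathbb{C}^{n\times n\times n_3}$ is determined by $L(\mathcal{I})^{(i)}=\mathbf{I}_n$ for all $i$. A tensor $\mathcal{Q}\in\mathbb{C}^{n\times n\times n_3}$ is unitary if $\mathcal{Q}^H*_c\mathcal{Q}=\mathcal{Q}*_c\mathcal{Q}^H=\mathcal{I}$. A tensor is F-upper if all its frontal slices are upper triangular matrices. A C-Schur decomposition of $\mathcal{A}\in\mathbb{C}^{n\times n\times n_3}$ is a factorization $\mathcal{A}=\mathcal{Q}^H*_c\mathcal{T}*_c\mathcal{Q}$ with $\mathcal{Q}\in\mathbb{C}^{n\times n\times n_3}$ unitary and $\mathcal{T}\in\mathbb{C}^{n\times n\times n_3}$ F-upper. The Moore-Penrose inverse $\mathcal{A}^\dagger$ is the (unique) tensor $\mathcal{X}$ with $\mathcal{A}*_c\mathcal{X}*_c\mathcal{A}=\mathcal{A}$, $\mathcal{X}*_c\mathcal{A}*_c\mathcal{X}=\mathcal{X}$, $(\mathcal{A}*_c\mathcal{X})^H=\mathcal{A}*_c\mathcal{X}$, $(\mathcal{X}*_c\mathcal{A})^H=\mathcal{X}*_c\mathcal{A}$. *)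

theory Defs
  imports
    Complex_Main
    "Jordan_Normal_Form.Gauss_Jordan_Elimination"
    "Jordan_Normal_Form.Schur_Decomposition"
begin

text \<open>A third-order tensor is the list of its frontal slices, so entry (i,j,k) of \<open>A\<close>
  is \<open>(A ! k) $$ (i,j)\<close> and the third dimension is \<open>length A\<close>.  All indices are 0-based.\<close>

type_synonym tensor = "complex mat list"

definition carrier_tensor :: "nat \<Rightarrow> nat \<Rightarrow> nat \<Rightarrow> tensor set" where
  "carrier_tensor n1 n2 n3 = {A. length A = n3 \<and> (\<forall>k<n3. A ! k \<in> carrier_mat n1 n2)}"

text \<open>The first two dimensions are read off the first slice.  They are unspecified for the
  empty list, but \<open>carrier_tensor n1 n2 0 = {[]}\<close> for all \<open>n1\<close>, \<open>n2\<close>.\<close>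

definition tdim1 :: "tensor \<Rightarrow> nat" where "tdim1 A = dim_row (A ! 0)"
definition tdim2 :: "tensor \<Rightarrow> nat" where "tdim2 A = dim_col (A ! 0)"

text \<open>With 0-based indices \<open>j\<close>, \<open>k\<close> the factor \<open>(j-1)(2k-1)\<close> of the usual 1-based formula
  becomes \<open>j(2k+1)\<close>.\<close>

definition dct_mat :: "nat \<Rightarrow> complex mat" where
  "dct_mat n = mat n n (\<lambda>(j,k). complex_of_real
     (sqrt ((if j = 0 then 1 else 2) / real n)
      * cos (real j * (2 * real k + 1) * pi / (2 * real n))))"

definition W_mat :: "nat \<Rightarrow> complex mat" where
  "W_mat n = mat_diag n (\<lambda>j. dct_mat n $$ (j,0))"

definition Z_mat :: "nat \<Rightarrow> complex mat" where
  "Z_mat n = mat n n (\<lambda>(i,j). if j = i + 1 then 1 else 0)"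

definition M_mat :: "nat \<Rightarrow> complex mat" where
  "M_mat n = the (mat_inverse (W_mat n)) * dct_mat n * (1\<^sub>m n + Z_mat n)"

definition L :: "tensor \<Rightarrow> tensor" where
  "L A = map (\<lambda>k. mat (tdim1 A) (tdim2 A)
      (\<lambda>(i,j). \<Sum>l<length A. M_mat (length A) $$ (k,l) * (A ! l) $$ (i,j)))
    [0..<length A]"

text \<open>As \<open>L\<close> is a bijection of each \<open>carrier_tensor n1 n2 n3\<close>, a tensor of given dimensions
  is determined by its image; the next three operations are defined in this way.\<close>

definition cprod :: "tensor \<Rightarrow> tensor \<Rightarrow> tensor"  (infixl "*\<^sub>c" 70) where
  "A *\<^sub>c B = (THE C. C \<in> carrier_tensor (tdim1 A) (tdim2 B) (length A)
     \<and> (\<forall>i<length A. L C ! i = L A ! i * L B ! i))"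

definition ctranspose :: "tensor \<Rightarrow> tensor" where
  "ctranspose A = (THE C. C \<in> carrier_tensor (tdim2 A) (tdim1 A) (length A)
     \<and> (\<forall>i<length A. L C ! i = mat_adjoint (L A ! i)))"

definition id_tensor :: "nat \<Rightarrow> nat \<Rightarrow> tensor" where
  "id_tensor n n3 = (THE C. C \<in> carrier_tensor n n n3 \<and> (\<forall>i<n3. L C ! i = 1\<^sub>m n))"

definition unitary_tensor :: "nat \<Rightarrow> nat \<Rightarrow> tensor \<Rightarrow> bool" where
  "unitary_tensor n n3 Q \<longleftrightarrow> Q \<in> carrier_tensor n n n3
     \<and> ctranspose Q *\<^sub>c Q = id_tensor n n3 \<and> Q *\<^sub>c ctranspose Q = id_tensor n n3"

definition F_upper :: "tensor \<Rightarrow> bool" where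
  "F_upper T \<longleftrightarrow> (\<forall>k<length T. upper_triangular (T ! k))"

definition C_Schur_decomposition ::
    "nat \<Rightarrow> nat \<Rightarrow> tensor \<Rightarrow> tensor \<Rightarrow> tensor \<Rightarrow> bool" where
  "C_Schur_decomposition n n3 A Q T \<longleftrightarrow>
     unitary_tensor n n3 Q \<and> T \<in> carrier_tensor n n n3 \<and> F_upper T
     \<and> A = ctranspose Q *\<^sub>c T *\<^sub>c Q"

definition is_MP_inverse :: "tensor \<Rightarrow> tensor \<Rightarrow> bool" where
  "is_MP_inverse A X \<longleftrightarrow> X \<in> carrier_tensor (tdim2 A) (tdim1 A) (length A)
     \<and> A *\<^sub>c X *\<^sub>c A = A \<and> X *\<^sub>c A *\<^sub>c X = X
     \<and> ctranspose (A *\<^sub>c X) = A *\<^sub>c X \<and> ctranspose (X *\<^sub>c A) = X *\<^sub>c A"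

definition MP_inverse :: "tensor \<Rightarrow> tensor" where
  "MP_inverse A = (THE X. is_MP_inverse A X)"

end

theory Submission
  imports Defs
begin

text \<open>
  The map \<^term>\<open>L\<close> is a bijection from tensors to tensors that turns the C-product, the
  conjugate transpose and the identity tensor into the ordinary matrix operations on each frontal
  slice (\<open>L_bij\<close>, \<open>cprod_L\<close>, \<open>ctranspose_L\<close>, \<open>id_tensor_L\<close>).  Hence the four Penrose equations for
  tensors hold if and only if they hold for every pair of transformed slices
  (\<open>is_MP_inverse_iff_slices\<close>), and \<open>L Q\<close> has unitary slices.  What remains is
  the matrix fact that unitary conjugation carries a Moore-Penrose inverse to a Moore-Penrose
  inverse: in a product of conjugates the inner factors \<open>U U\<^sup>H\<close> cancel
  (\<open>mat_MP_inverse_unitary_conj\<close>).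

  As \<^term>\<open>MP_inverse\<close> is a definite description, this argument needs existence (for \<open>T\<close>) and
  uniqueness (for \<open>A\<close>) of the Moore-Penrose inverse, which again are matrix facts.  Existence starts
  from Gauss-Jordan elimination: a matrix in reduced row echelon form has an explicit
  generalized inverse, so every matrix \<open>A\<close> has some \<open>Y\<close> with \<open>A Y A = A\<close>.  Such a \<open>Y\<close> for the Gram
  matrix of \<open>A\<close> gives an \<open>X\<close> for which moreover \<open>A X\<close> is Hermitian, the same for \<open>A\<^sup>H\<close> gives a \<open>V\<close>
  for which \<open>V A\<close> is Hermitian, and \<open>V A X\<close> is the Moore-Penrose inverse.

  The bijectivity of \<^term>\<open>L\<close> is the invertibility of the transform matrix.  It is a product of three
  factors, namely the inverse of a diagonal matrix without zeros on its diagonal, the orthogonal DCT matrix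
  and a unitriangular matrix.
\<close>

section \<open>Matrix algebra\<close>

text \<open>Associativity conditioned on dimensions rather than on carriers: the
  simplifier can discharge these conditions by computing dimensions.\<close>

lemma mat_assoc_dim:
  fixes A B C :: "'a :: semiring_0 mat"
  assumes "dim_col A = dim_row B" and "dim_col B = dim_row C"
  shows "A * B * C = A * (B * C)"
  by (rule assoc_mult_mat[of A "dim_row A" "dim_row B" B "dim_row C" C "dim_col C"])
    (use assms in \<open>auto intro: carrier_matI\<close>)

lemma mat_adjoint_dim [simp]:
  "dim_row (mat_adjoint A) = dim_col A" "dim_col (mat_adjoint A) = dim_row A"
  by (simp_all add: mat_adjoint_def)

lemma mat_adjoint_index [simp]:
  "i < dim_col A \<Longrightarrow> j < dim_row A \<Longrightarrow> mat_adjoint A $$ (i,j) = conjugate (A $$ (j,i))"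
  by (simp add: mat_adjoint_def mat_of_rows_index)

lemma mat_adjoint_adjoint [simp]: "mat_adjoint (mat_adjoint A) = (A :: complex mat)"
  by (rule eq_matI) auto

lemma mat_adjoint_mult:
  fixes A B :: "complex mat"
  assumes "dim_col A = dim_row B"
  shows "mat_adjoint (A * B) = mat_adjoint B * mat_adjoint A"
  by (rule eq_matI) (use assms in \<open>auto simp: scalar_prod_def mult.commute intro!: sum.cong\<close>)

text \<open>The diagonal entries of a Gram matrix are the squared norms of the columns.\<close>

lemma gram_eq_0_imp_eq_0:
  fixes B :: "complex mat"
  assumes B: "B \<in> carrier_mat m n" and gram: "mat_adjoint B * B = 0\<^sub>m n n"
  shows "B = 0\<^sub>m m n"
proof (rule eq_matI)
  fix i j assume "i < dim_row (0\<^sub>m m n :: complex mat)" "j < dim_col (0\<^sub>m m n :: complex mat)"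
  then have ij: "i < m" "j < n" by auto
  have "of_real (\<Sum>k<m. (cmod (B $$ (k,j)))\<^sup>2) = (mat_adjoint B * B) $$ (j,j)"
    using B ij by (auto simp: scalar_prod_def complex_norm_square mult.commute
        lessThan_atLeast0 simp del: of_real_power intro!: sum.cong)
  also have "\<dots> = 0" using gram ij by simp
  finally have "(\<Sum>k<m. (cmod (B $$ (k,j)))\<^sup>2) = 0" by (simp only: of_real_eq_0_iff)
  then have "(cmod (B $$ (i,j)))\<^sup>2 = 0"
    by (subst (asm) sum_nonneg_eq_0_iff) (use ij in auto)
  then show "B $$ (i,j) = 0\<^sub>m m n $$ (i,j)" using ij by simp
qed (use B in auto)

text \<open>The difference \<open>B\<close> of the two sides has the Gram matrix
  \<open>B\<^sup>H B = (D - E)\<^sup>H (A\<^sup>H B)\<close>, which vanishes because \<open>A\<^sup>H B = 0\<close> is the hypothesis.\<close>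

lemma gram_mult_left_cancel:
  fixes A D E :: "complex mat"
  assumes A: "A \<in> carrier_mat m n" and D: "D \<in> carrier_mat n k" and E: "E \<in> carrier_mat n k"
    and eq: "mat_adjoint A * (A * D) = mat_adjoint A * (A * E)"
  shows "A * D = A * E"
proof -
  have AH: "mat_adjoint A \<in> carrier_mat n m" using A by (auto intro: carrier_matI)
  have AD: "A * D \<in> carrier_mat m k" and AE: "A * E \<in> carrier_mat m k" using A D E by auto
  define B where "B = A * D - A * E"
  have B: "B \<in> carrier_mat m k" using A D E by (auto simp: B_def)
  have B': "B = A * (D - E)" using mult_minus_distrib_mat[OF A D E] by (simp add: B_def)
  have AB: "mat_adjoint A * B = 0\<^sub>m n k"
    unfolding B_def mult_minus_distrib_mat[OF AH AD AE] eq
    by (rule minus_r_inv_mat) (use A E in auto)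
  have "mat_adjoint B * B = mat_adjoint (D - E) * (mat_adjoint A * B)"
    using A D E B by (subst B') (simp add: mat_adjoint_mult mat_assoc_dim)
  also have "\<dots> = 0\<^sub>m k k" unfolding AB using D E by (intro right_mult_zero_mat) auto
  finally have "B = 0\<^sub>m m k" by (rule gram_eq_0_imp_eq_0[OF B])
  then have entry: "\<And>i j. i < m \<Longrightarrow> j < k \<Longrightarrow> (A * D - A * E) $$ (i,j) = 0" by (simp add: B_def)
  show ?thesis
    by (rule eq_matI) (use A D E entry in auto)
qed

section \<open>The Moore-Penrose inverse of a complex matrix\<close>

definition mat_MP_inverse :: "complex mat \<Rightarrow> complex mat \<Rightarrow> bool" where
  "mat_MP_inverse A X \<longleftrightarrow> X \<in> carrier_mat (dim_col A) (dim_row A)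
     \<and> A * X * A = A \<and> X * A * X = X
     \<and> mat_adjoint (A * X) = A * X \<and> mat_adjoint (X * A) = X * A"

text \<open>Both \<open>A X\<close> and \<open>A Y\<close> are Hermitian, and \<open>A X = (A Y) (A X)\<close>; taking adjoints gives
  \<open>A X = (A X) (A Y) = A Y\<close>.  Likewise \<open>X A = Y A\<close>, so \<open>X = X A X = Y A Y = Y\<close>.\<close>

lemma mat_MP_inverse_unique:
  assumes X: "mat_MP_inverse A X" and Y: "mat_MP_inverse A Y"
  shows "X = Y"
proof -
  have dims [simp]: "dim_row X = dim_col A" "dim_col X = dim_row A"
      "dim_row Y = dim_col A" "dim_col Y = dim_row A"
    using X Y by (auto simp: mat_MP_inverse_def)
  note X' = X[unfolded mat_MP_inverse_def] and Y' = Y[unfolded mat_MP_inverse_def]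
  have "A * X = (A * Y * A) * X" using Y' by simp
  also have "\<dots> = (A * Y) * (A * X)" by (simp add: mat_assoc_dim)
  finally have "A * X = (A * Y) * (A * X)" .
  then have "mat_adjoint (A * X) = mat_adjoint ((A * Y) * (A * X))" by simp
  also have "\<dots> = mat_adjoint (A * X) * mat_adjoint (A * Y)" by (rule mat_adjoint_mult) simp
  finally have "A * X = (A * X) * (A * Y)" using X' Y' by simp
  also have "\<dots> = (A * X * A) * Y" by (simp add: mat_assoc_dim)
  finally have AX: "A * X = A * Y" using X' by simp
  have "X * A = X * (A * Y * A)" using Y' by simp
  also have "\<dots> = (X * A) * (Y * A)" by (simp add: mat_assoc_dim)
  finally have "X * A = (X * A) * (Y * A)" .
  then have "mat_adjoint (X * A) = mat_adjoint ((X * A) * (Y * A))" by simp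
  also have "\<dots> = mat_adjoint (Y * A) * mat_adjoint (X * A)" by (rule mat_adjoint_mult) simp
  finally have "X * A = (Y * A) * (X * A)" using X' Y' by simp
  also have "\<dots> = Y * (A * X * A)" by (simp add: mat_assoc_dim)
  finally have XA: "X * A = Y * A" using X' by simp
  have "X = X * A * X" using X' by simp
  also have "\<dots> = Y * (A * X)" unfolding XA by (simp add: mat_assoc_dim)
  also have "\<dots> = Y * A * Y" unfolding AX by (simp add: mat_assoc_dim)
  also have "\<dots> = Y" using Y' by simp
  finally show ?thesis .
qed

text \<open>Let \<open>Y\<close> place a 1 at position \<open>(f i, i)\<close> for every pivot column \<open>f i\<close>.  Column \<open>i\<close> of \<open>R Y\<close> is
  then the pivot column \<open>f i\<close> of \<open>R\<close>, a unit vector, so \<open>R Y\<close> is the diagonal projection onto the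
  nonzero rows of \<open>R\<close> and fixes \<open>R\<close>.\<close>

lemma row_echelon_generalized_inverse:
  fixes R :: "'a :: field mat"
  assumes R: "R \<in> carrier_mat m n" and ech: "row_echelon_form R"
  shows "\<exists>Y \<in> carrier_mat n m. R * Y * R = R"
proof -
  obtain f where "pivot_fun R f n" using ech R by (auto simp: row_echelon_form_def)
  \<comment> \<open>A zero row \<open>i\<close> is marked by \<open>f i = n\<close>; in that case column \<open>i\<close> of \<open>Y\<close> below is zero.\<close>
  note p = pivot_funD[OF carrier_matD(1)[OF R] this]
  define Y :: "'a mat" where "Y = mat n m (\<lambda>(j,i). if j = f i then 1 else 0)"
  have Y: "Y \<in> carrier_mat n m" by (simp add: Y_def)
  have RY: "R * Y = mat_diag m (\<lambda>i. if f i < n then 1 else 0)"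
  proof (rule eq_matI)
    fix i k assume "i < dim_row (mat_diag m (\<lambda>i. if f i < n then 1 else 0 :: 'a))"
      "k < dim_col (mat_diag m (\<lambda>i. if f i < n then 1 else 0 :: 'a))"
    then have ik: "i < m" "k < m" by (auto simp: mat_diag_def)
    have "(R * Y) $$ (i,k) = (\<Sum>j = 0..<n. R $$ (i,j) * (if j = f k then 1 else 0))"
      using R ik by (auto simp: scalar_prod_def Y_def)
    also have "\<dots> = (if f k < n then R $$ (i, f k) else 0)"
      by (simp add: if_distrib[of "\<lambda>x. _ * x"] cong: if_cong)
    also have "\<dots> = mat_diag m (\<lambda>i. if f i < n then 1 else 0) $$ (i,k)"
      using ik p(4)[of k] p(5)[of k i] by (auto simp: mat_diag_def)
    finally show "(R * Y) $$ (i,k) = mat_diag m (\<lambda>i. if f i < n then 1 else 0) $$ (i,k)" .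
  qed (use R Y in \<open>auto simp: mat_diag_def\<close>)
  have "R * Y * R = R"
    unfolding RY mat_diag_mult_left[OF R]
    by (rule eq_matI) (use R p(1,2) in \<open>auto simp: not_less dest: le_antisym\<close>)
  with Y show ?thesis by blast
qed

lemma generalized_inverse_exists:
  fixes A :: "'a :: field mat"
  assumes A: "A \<in> carrier_mat m n"
  shows "\<exists>Y \<in> carrier_mat n m. A * Y * A = A"
proof -
  define R where "R = gauss_jordan_single A"
  note gj = gauss_jordan_single[OF A R_def[symmetric]]
  obtain P Q where PQ: "R = P * A" "P \<in> carrier_mat m m" "Q \<in> carrier_mat m m" "Q * P = 1\<^sub>m m"
    using gj(4) by blast
  obtain Y where Y: "Y \<in> carrier_mat n m" "R * Y * R = R"
    using row_echelon_generalized_inverse[OF gj(2,3)] by blast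
  have QR: "Q * R = A"
    using PQ A by (simp add: PQ(1) flip: assoc_mult_mat[OF PQ(3,2) A])
  have "A * (Y * P) * A = Q * R * (Y * P) * A" by (simp add: QR)
  also have "\<dots> = Q * (R * Y * R)" using PQ A Y by (simp add: mat_assoc_dim)
  also have "\<dots> = A" by (simp add: Y QR)
  finally show ?thesis using Y PQ by (intro bexI[of _ "Y * P"]) auto
qed

text \<open>If \<open>G\<close> is a generalized inverse of \<open>A\<^sup>H A\<close>, then \<open>X = G A\<^sup>H\<close> solves the normal equations
  \<open>A\<^sup>H A X A = A\<^sup>H A\<close>, and the factor \<open>A\<^sup>H\<close> cancels.  Replacing \<open>A\<^sup>H\<close> by \<open>A\<^sup>H (A X)\<^sup>H\<close> in
  \<open>A X = A G A\<^sup>H\<close> shows \<open>A X = (A X) (A X)\<^sup>H\<close>, which is Hermitian.\<close>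

lemma hermitian_right_generalized_inverse:
  fixes A :: "complex mat"
  assumes A: "A \<in> carrier_mat m n"
  shows "\<exists>X \<in> carrier_mat n m. A * X * A = A \<and> mat_adjoint (A * X) = A * X"
proof -
  have dA [simp]: "dim_row A = m" "dim_col A = n" using A by auto
  have "mat_adjoint A * A \<in> carrier_mat n n" by (intro carrier_matI) simp_all
  from generalized_inverse_exists[OF this]
  obtain G where G: "G \<in> carrier_mat n n"
    and GG: "mat_adjoint A * A * G * (mat_adjoint A * A) = mat_adjoint A * A" by blast
  have dG [simp]: "dim_row G = n" "dim_col G = n" using G by auto
  define X where "X = G * mat_adjoint A"
  have dX [simp]: "dim_row X = n" "dim_col X = m" by (simp_all add: X_def)
  have "A * (X * A) = A * 1\<^sub>m n"
  proof (rule gram_mult_left_cancel[OF A])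
    show "mat_adjoint A * (A * (X * A)) = mat_adjoint A * (A * 1\<^sub>m n)"
      using GG by (simp add: X_def mat_assoc_dim right_mult_one_mat')
  qed (auto intro: carrier_matI)
  then have AXA: "A * X * A = A" by (simp add: mat_assoc_dim right_mult_one_mat')
  have "mat_adjoint A = mat_adjoint (A * X * A)" by (simp add: AXA)
  then have AH: "mat_adjoint A = mat_adjoint A * mat_adjoint (A * X)"
    by (simp add: mat_adjoint_mult)
  have "A * X = A * G * mat_adjoint A" by (simp add: X_def mat_assoc_dim)
  also have "\<dots> = A * G * (mat_adjoint A * mat_adjoint (A * X))" using AH by simp
  also have "\<dots> = A * X * mat_adjoint (A * X)" by (simp add: X_def mat_assoc_dim)
  finally have AX: "A * X = A * X * mat_adjoint (A * X)" .
  then have "mat_adjoint (A * X) = mat_adjoint (A * X * mat_adjoint (A * X))" by simp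
  also have "\<dots> = A * X * mat_adjoint (A * X)" by (subst mat_adjoint_mult) simp_all
  finally have "mat_adjoint (A * X) = A * X" using AX by simp
  with AXA show ?thesis by (intro bexI[of _ X]) (auto intro: carrier_matI)
qed

text \<open>Take \<open>X\<close> and \<open>V\<close> with \<open>A X A = A = A V A\<close>, with \<open>A X\<close> Hermitian and, by passing to the adjoint,
  with \<open>V A\<close> Hermitian.  The product \<open>V A X\<close> inherits both symmetries because
  \<open>A (V A X) = A X\<close> and \<open>(V A X) A = V A\<close>.\<close>

lemma mat_MP_inverse_exists: "\<exists>X. mat_MP_inverse A X"
proof -
  obtain X where X: "X \<in> carrier_mat (dim_col A) (dim_row A)"
    "A * X * A = A" "mat_adjoint (A * X) = A * X"
    using hermitian_right_generalized_inverse[of A "dim_row A" "dim_col A"] by auto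
  obtain Z where Z: "Z \<in> carrier_mat (dim_row A) (dim_col A)"
    "mat_adjoint A * Z * mat_adjoint A = mat_adjoint A"
    "mat_adjoint (mat_adjoint A * Z) = mat_adjoint A * Z"
    using hermitian_right_generalized_inverse[of "mat_adjoint A" "dim_col A" "dim_row A"]
    by (metis carrier_matI mat_adjoint_dim)
  have d [simp]: "dim_row X = dim_col A" "dim_col X = dim_row A"
    "dim_row Z = dim_row A" "dim_col Z = dim_col A" using X Z by auto
  define V where "V = mat_adjoint Z"
  have dV [simp]: "dim_row V = dim_col A" "dim_col V = dim_row A" by (auto simp: V_def)
  have "mat_adjoint (mat_adjoint A * Z * mat_adjoint A) = A" using Z(2) by simp
  then have AVA: "A * V * A = A" by (simp add: V_def mat_adjoint_mult mat_assoc_dim)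
  have VA: "mat_adjoint (V * A) = V * A"
    using Z(3) by (simp add: V_def mat_adjoint_mult)
  have 1: "A * (V * A * X) = A * X" using AVA by (simp flip: mat_assoc_dim)
  have 2: "V * A * X * A = V * A" using X(2) by (simp add: mat_assoc_dim)
  have "V * A * X * A * (V * A * X) = V * (A * V * A) * X" unfolding 2 by (simp add: mat_assoc_dim)
  then have "mat_MP_inverse A (V * A * X)"
    unfolding mat_MP_inverse_def 1 2 using X VA AVA 2 by (auto intro: carrier_matI)
  then show ?thesis by blast
qed

lemma mat_MP_inverse_unitary_conj:
  assumes B: "B \<in> carrier_mat n n" and U: "U \<in> carrier_mat n n"
    and UU: "U * mat_adjoint U = 1\<^sub>m n"
    and Y: "mat_MP_inverse B Y"
  shows "mat_MP_inverse (mat_adjoint U * B * U) (mat_adjoint U * Y * U)"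
proof -
  have d [simp]: "dim_row U = n" "dim_col U = n" "dim_row B = n" "dim_col B = n"
    "dim_row Y = n" "dim_col Y = n"
    using B U Y by (auto simp: mat_MP_inverse_def)
  have conj_mult: "(mat_adjoint U * S * U) * (mat_adjoint U * R * U) = mat_adjoint U * (S * R) * U"
    if [simp]: "dim_row S = n" "dim_col S = n" "dim_row R = n" "dim_col R = n" for S R
  proof -
    have "(mat_adjoint U * S * U) * (mat_adjoint U * R * U)
        = mat_adjoint U * S * (U * mat_adjoint U) * R * U"
      by (simp add: mat_assoc_dim)
    also have "\<dots> = mat_adjoint U * (S * R) * U"
      by (simp add: UU mat_assoc_dim right_mult_one_mat' left_mult_one_mat')
    finally show ?thesis .
  qed
  have conj_adj: "mat_adjoint (mat_adjoint U * S * U) = mat_adjoint U * mat_adjoint S * U"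
    if [simp]: "dim_row S = n" "dim_col S = n" for S
    by (simp add: mat_adjoint_mult mat_assoc_dim)
  show ?thesis using Y unfolding mat_MP_inverse_def
    by (auto simp: conj_mult conj_adj intro!: carrier_matI)
qed

section \<open>Invertibility of the transform matrix\<close>

text \<open>Multiplied by \<open>2 sin x\<close>, each summand becomes \<open>sin ((2k + 2) x) - sin (2k x)\<close> and the sum telescopes.\<close>

lemma sum_cos_odd_multiples:
  assumes "sin x \<noteq> (0::real)"
  shows "(\<Sum>k<n. cos ((2 * real k + 1) * x)) = sin (2 * real n * x) / (2 * sin x)"
proof -
  have step: "2 * sin x * cos ((2 * real k + 1) * x) = sin (2 * real (Suc k) * x) - sin (2 * real k * x)"
    for k
  proof -
    have "sin (2 * real (Suc k) * x) = sin ((2 * real k + 1) * x + x)"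
      "sin (2 * real k * x) = sin ((2 * real k + 1) * x - x)"
      by (simp_all add: algebra_simps)
    then show ?thesis by (simp only: sin_add sin_diff) simp
  qed
  have "2 * sin x * (\<Sum>k<n. cos ((2 * real k + 1) * x)) = sin (2 * real n * x)"
    unfolding sum_distrib_left step by (subst sum_lessThan_telescope) simp
  then show ?thesis using assms by (simp add: field_simps)
qed

text \<open>For \<open>x = r \<pi> / (2n)\<close> the closed form has numerator \<open>sin (r \<pi>) = 0\<close>, and the bounds on \<open>r\<close>
  keep \<open>x\<close> strictly between \<open>- \<pi>\<close> and \<open>\<pi>\<close>, away from the zeros of the denominator.\<close>

lemma sum_cos_dct:
  fixes r :: int
  assumes r: "r \<noteq> 0" "\<bar>r\<bar> < 2 * int n"
  shows "(\<Sum>k<n. cos ((2 * real k + 1) * (of_int r * pi / (2 * real n)))) = 0"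
proof -
  define x where "x = of_int r * pi / (2 * real n)"
  have n: "n > 0" using r by auto
  have "sin x \<noteq> 0"
  proof
    assume "sin x = 0"
    then obtain i :: int where "x = of_int i * pi" by (auto simp: sin_zero_iff_int2)
    then have "of_int r = (of_int (i * (2 * int n)) :: real)"
      using n by (simp add: x_def field_simps)
    then have "r = i * (2 * int n)" by (simp only: of_int_eq_iff)
    then have "2 * int n dvd r" by simp
    then show False using r by (auto dest: dvd_imp_le_int)
  qed
  moreover have "2 * real n * x = of_int r * pi" using n by (simp add: x_def)
  then have "sin (2 * real n * x) = 0" by (simp add: sin_zero_iff_int2)
  ultimately show ?thesis using sum_cos_odd_multiples[of x n] by (simp add: x_def)
qed

lemma dct_mat_carrier [simp]: "dct_mat n \<in> carrier_mat n n"
  by (simp add: dct_mat_def)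

text \<open>The product-to-sum formula turns the inner product of rows \<open>i\<close> and \<open>j\<close> into the cosine sums of
  frequencies \<open>i - j\<close> and \<open>i + j\<close>, which vanish unless the frequency is 0.  Both are 0 only for
  \<open>i = j = 0\<close>, which is why row 0 has a smaller normalizing factor.\<close>

lemma dct_orthogonal: "dct_mat n * transpose_mat (dct_mat n) = 1\<^sub>m n"
proof (rule eq_matI)
  fix i j assume "i < dim_row (1\<^sub>m n :: complex mat)" "j < dim_col (1\<^sub>m n :: complex mat)"
  then have ij: "i < n" "j < n" by auto
  then have n: "n > 0" by simp
  define w where "w = (\<lambda>j. sqrt ((if j = (0::nat) then 1 else 2) / real n))"
  define c where "c = (\<lambda>r::int. \<Sum>k<n. cos ((2 * real k + 1) * (of_int r * pi / (2 * real n))))"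
  have c: "c r = 0" if "r \<noteq> 0" "\<bar>r\<bar> < 2 * int n" for r
    using sum_cos_dct[OF that] by (simp add: c_def)
  have c0: "c 0 = real n" by (simp add: c_def)
  have "(dct_mat n * transpose_mat (dct_mat n)) $$ (i,j) = of_real (\<Sum>k<n.
      (w i * cos (real i * (2 * real k + 1) * pi / (2 * real n))) *
      (w j * cos (real j * (2 * real k + 1) * pi / (2 * real n))))"
    using ij by (simp add: dct_mat_def scalar_prod_def w_def lessThan_atLeast0)
  also have "(\<Sum>k<n. (w i * cos (real i * (2 * real k + 1) * pi / (2 * real n))) *
      (w j * cos (real j * (2 * real k + 1) * pi / (2 * real n))))
    = w i * w j / 2 * (c (int i - int j) + c (int i + int j))"
    unfolding c_def sum.distrib[symmetric] sum_distrib_left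
  proof (rule sum.cong[OF refl])
    fix k
    have "cos ((2 * real k + 1) * (of_int (int i - int j) * pi / (2 * real n)))
        + cos ((2 * real k + 1) * (of_int (int i + int j) * pi / (2 * real n)))
      = 2 * (cos (real i * (2 * real k + 1) * pi / (2 * real n))
           * cos (real j * (2 * real k + 1) * pi / (2 * real n)))"
      unfolding cos_times_cos by (simp add: algebra_simps diff_divide_distrib add_divide_distrib)
    then show "(w i * cos (real i * (2 * real k + 1) * pi / (2 * real n))) *
      (w j * cos (real j * (2 * real k + 1) * pi / (2 * real n))) =
      w i * w j / 2 * (cos ((2 * real k + 1) * (of_int (int i - int j) * pi / (2 * real n)))
        + cos ((2 * real k + 1) * (of_int (int i + int j) * pi / (2 * real n))))"
      by simp
  qed
  also have "\<dots> = (if i = j then 1 else 0)"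
  proof (cases "i = j")
    case False
    then show ?thesis using ij by (simp add: c)
  next
    case True
    have "w i * w i = (if i = 0 then 1 else 2) / real n" by (simp add: w_def)
    moreover have "c (int i + int i) = (if i = 0 then real n else 0)"
      using ij by (simp add: c c0)
    ultimately show ?thesis using True n by (auto simp: c0)
  qed
  finally show "(dct_mat n * transpose_mat (dct_mat n)) $$ (i,j) = 1\<^sub>m n $$ (i,j)"
    using ij by simp
qed (auto simp: dct_mat_def)

text \<open>The diagonal of \<^term>\<open>W_mat n\<close> consists of positive multiples of \<open>cos (j \<pi> / (2n))\<close> with \<open>j < n\<close>,
  and these angles stay below \<open>\<pi> / 2\<close>.\<close>

lemma W_mat_inverse:
  "\<exists>V \<in> carrier_mat n n. mat_inverse (W_mat n) = Some V \<and> W_mat n * V = 1\<^sub>m n"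
proof -
  have nz: "dct_mat n $$ (j,0) \<noteq> 0" if j: "j < n" for j
  proof -
    have "0 < cos (real j * pi / (2 * real n))"
      using j by (intro cos_gt_zero_pi) (auto simp: field_simps intro: less_le_trans[of _ 0])
    moreover have "sqrt ((if j = 0 then 1 else 2) / real n) \<noteq> 0" using j by auto
    ultimately show ?thesis using j by (simp add: dct_mat_def)
  qed
  have W: "W_mat n \<in> carrier_mat n n" by (simp add: W_mat_def)
  have "det (W_mat n) = prod_list (diag_mat (W_mat n))"
    by (rule det_upper_triangular[OF _ W]) (auto simp: W_mat_def mat_diag_def)
  also have "\<dots> \<noteq> 0" using nz by (auto simp: prod_list_zero_iff diag_mat_def W_mat_def mat_diag_def)
  finally have "det (W_mat n) \<noteq> 0" .
  from det_non_zero_imp_unit[OF W this, of "()"]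
  obtain V where "mat_inverse (W_mat n) = Some V"
    using mat_inverse(1)[OF W, of "()"] by (cases "mat_inverse (W_mat n)") auto
  then show ?thesis using mat_inverse(2)[OF W] by blast
qed

lemma M_mat_invertible:
  "M_mat n \<in> carrier_mat n n
   \<and> (\<exists>N \<in> carrier_mat n n. M_mat n * N = 1\<^sub>m n \<and> N * M_mat n = 1\<^sub>m n)"
proof -
  obtain V where V: "V \<in> carrier_mat n n" "mat_inverse (W_mat n) = Some V" "W_mat n * V = 1\<^sub>m n"
    using W_mat_inverse by blast
  have W: "W_mat n \<in> carrier_mat n n" by (simp add: W_mat_def)
  have Z: "1\<^sub>m n + Z_mat n \<in> carrier_mat n n" by (simp add: Z_mat_def)
  have M: "M_mat n = V * dct_mat n * (1\<^sub>m n + Z_mat n)" by (simp add: M_mat_def V)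
  have VC: "V * dct_mat n \<in> carrier_mat n n" by (rule mult_carrier_mat[OF V(1) dct_mat_carrier])
  have Mc: "M_mat n \<in> carrier_mat n n" unfolding M by (rule mult_carrier_mat[OF VC Z])
  have "det V \<noteq> 0" using det_mult[OF W V(1)] V(3) by auto
  moreover have "det (dct_mat n) \<noteq> 0"
    using det_mult[of "dct_mat n" n "transpose_mat (dct_mat n)"] dct_orthogonal[of n] by auto
  moreover have "det (1\<^sub>m n + Z_mat n) = 1"
    by (subst det_upper_triangular[OF _ Z])
      (auto simp: Z_mat_def diag_mat_def intro!: prod_list_neutral)
  ultimately have "det (M_mat n) \<noteq> 0"
    unfolding M by (simp add: det_mult[OF VC Z] det_mult[OF V(1) dct_mat_carrier])
  from det_non_zero_imp_unit[OF Mc this, of "()"] Mc show ?thesis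
    by (auto simp: Units_def ring_mat_def)
qed

section \<open>Tensors and their images under the transform\<close>

text \<open>With third dimension 0 the empty tensor lies in every carrier.  So
  the dimensions read off the first slice determine the right carrier even when there is no slice.\<close>

lemma carrier_tensor_0: "carrier_tensor a b 0 = carrier_tensor c d 0"
  by (auto simp: carrier_tensor_def)

lemma carrier_tensor_tdim:
  assumes "A \<in> carrier_tensor n1 m n3" "B \<in> carrier_tensor m' n2 n3"
  shows "carrier_tensor (tdim1 A) (tdim2 B) n3 = carrier_tensor n1 n2 n3"
    and "carrier_tensor (tdim2 B) (tdim1 A) n3 = carrier_tensor n2 n1 n3"
proof -
  have "tdim1 A = n1" "tdim2 B = n2" if "n3 \<noteq> 0"
    using assms that by (auto simp: carrier_tensor_def tdim1_def tdim2_def)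
  then show "carrier_tensor (tdim1 A) (tdim2 B) n3 = carrier_tensor n1 n2 n3"
    and "carrier_tensor (tdim2 B) (tdim1 A) n3 = carrier_tensor n2 n1 n3"
    by (metis carrier_tensor_0)+
qed

lemma L_nth:
  assumes "A \<in> carrier_tensor n1 n2 n3" "k < n3"
  shows "L A ! k = mat n1 n2 (\<lambda>(i,j). \<Sum>l<n3. M_mat n3 $$ (k,l) * (A ! l) $$ (i,j))"
proof -
  have "length A = n3" "A ! 0 \<in> carrier_mat n1 n2" using assms by (auto simp: carrier_tensor_def)
  with assms(2) show ?thesis by (simp add: L_def tdim1_def tdim2_def)
qed

lemma L_nth_carrier [simp]:
  "A \<in> carrier_tensor n1 n2 n3 \<Longrightarrow> k < n3 \<Longrightarrow> L A ! k \<in> carrier_mat n1 n2"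
  by (simp add: L_nth)

text \<open>The transform and its inverse act on each tube \<open>f\<close>, the entries at a fixed position
  \<open>(i, j)\<close> of all slices; applying both in either order gives back the tube.\<close>

lemma inverse_transform_cancel:
  fixes P Q :: "'a :: comm_ring_1 mat"
  assumes P: "P \<in> carrier_mat n n" and Q: "Q \<in> carrier_mat n n" and PQ: "P * Q = 1\<^sub>m n"
    and k: "k < n"
  shows "(\<Sum>l<n. P $$ (k,l) * (\<Sum>m<n. Q $$ (l,m) * f m)) = f k"
proof -
  have "(\<Sum>l<n. P $$ (k,l) * (\<Sum>m<n. Q $$ (l,m) * f m))
      = (\<Sum>m<n. (\<Sum>l<n. P $$ (k,l) * Q $$ (l,m)) * f m)"
    unfolding sum_distrib_left sum_distrib_right by (subst sum.swap) (simp add: mult.assoc)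
  also have "\<dots> = (\<Sum>m<n. (P * Q) $$ (k,m) * f m)"
    using P Q k by (auto simp: scalar_prod_def lessThan_atLeast0 intro!: sum.cong)
  also have "\<dots> = (\<Sum>m<n. if k = m then f m else 0)"
    unfolding PQ using k by (intro sum.cong) auto
  also have "\<dots> = f k" using k by simp
  finally show ?thesis .
qed

lemma tensor_eqI:
  assumes A: "A \<in> carrier_tensor n1 n2 n3" and B: "B \<in> carrier_tensor n1 n2 n3"
    and eq: "\<And>k. k < n3 \<Longrightarrow> L A ! k = L B ! k"
  shows "A = B"
proof -
  obtain N where N: "N \<in> carrier_mat n3 n3" "N * M_mat n3 = 1\<^sub>m n3"
    and M: "M_mat n3 \<in> carrier_mat n3 n3"
    using M_mat_invertible by blast
  have rec: "(C ! k) $$ (i,j) = (\<Sum>l<n3. N $$ (k,l) * (L C ! l) $$ (i,j))"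
    if C: "C \<in> carrier_tensor n1 n2 n3" and "k < n3" "i < n1" "j < n2" for C k i j
  proof -
    have "(\<Sum>l<n3. N $$ (k,l) * (L C ! l) $$ (i,j))
        = (\<Sum>l<n3. N $$ (k,l) * (\<Sum>m<n3. M_mat n3 $$ (l,m) * (C ! m) $$ (i,j)))"
      using that by (simp add: L_nth[OF C])
    then show ?thesis using inverse_transform_cancel[OF N(1) M N(2) that(2)] by simp
  qed
  show ?thesis
  proof (rule nth_equalityI)
    fix k assume "k < length A"
    then have k: "k < n3" using A by (simp add: carrier_tensor_def)
    have Ak: "A ! k \<in> carrier_mat n1 n2" and Bk: "B ! k \<in> carrier_mat n1 n2"
      using A B k by (auto simp: carrier_tensor_def)
    show "A ! k = B ! k"
    proof (rule eq_matI)
      fix i j assume "i < dim_row (B ! k)" "j < dim_col (B ! k)"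
      then have "i < n1" "j < n2" using Bk by auto
      then show "(A ! k) $$ (i,j) = (B ! k) $$ (i,j)"
        using rec[OF A k] rec[OF B k] eq by simp
    qed (use Ak Bk in auto)
  qed (use A B in \<open>auto simp: carrier_tensor_def\<close>)
qed

lemma L_bij:
  assumes G: "\<And>k. k < n3 \<Longrightarrow> G k \<in> carrier_mat n1 n2"
  shows "\<exists>!C. C \<in> carrier_tensor n1 n2 n3 \<and> (\<forall>k<n3. L C ! k = G k)"
proof -
  obtain N where N: "N \<in> carrier_mat n3 n3" "M_mat n3 * N = 1\<^sub>m n3"
    and M: "M_mat n3 \<in> carrier_mat n3 n3"
    using M_mat_invertible by blast
  define C where "C = map (\<lambda>l. mat n1 n2 (\<lambda>(i,j). \<Sum>m<n3. N $$ (l,m) * G m $$ (i,j))) [0..<n3]"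
  have C: "C \<in> carrier_tensor n1 n2 n3" by (auto simp: C_def carrier_tensor_def)
  have C_nth: "C ! l = mat n1 n2 (\<lambda>(i,j). \<Sum>m<n3. N $$ (l,m) * G m $$ (i,j))" if "l < n3" for l
    using that by (simp add: C_def)
  have "L C ! k = G k" if k: "k < n3" for k
  proof (rule eq_matI)
    fix i j assume "i < dim_row (G k)" "j < dim_col (G k)"
    then have "i < n1" "j < n2" using G[OF k] by auto
    then show "(L C ! k) $$ (i,j) = G k $$ (i,j)"
      using inverse_transform_cancel[OF M N k] by (simp add: L_nth[OF C k] C_nth)
  qed (use G[OF k] in \<open>auto simp: L_nth[OF C k]\<close>)
  with C show ?thesis by (intro ex1I[of _ C]) (auto intro: tensor_eqI)
qed

lemma cprod_L:
  assumes A: "A \<in> carrier_tensor n1 m n3" and B: "B \<in> carrier_tensor m n2 n3"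
  shows "A *\<^sub>c B \<in> carrier_tensor n1 n2 n3"
    and "\<And>k. k < n3 \<Longrightarrow> L (A *\<^sub>c B) ! k = L A ! k * L B ! k"
proof -
  have len: "length A = n3" using A by (simp add: carrier_tensor_def)
  have "\<exists>!C. C \<in> carrier_tensor n1 n2 n3 \<and> (\<forall>k<n3. L C ! k = L A ! k * L B ! k)"
    by (rule L_bij) (rule mult_carrier_mat[OF L_nth_carrier[OF A] L_nth_carrier[OF B]])
  from theI'[OF this]
  show "A *\<^sub>c B \<in> carrier_tensor n1 n2 n3"
    and "\<And>k. k < n3 \<Longrightarrow> L (A *\<^sub>c B) ! k = L A ! k * L B ! k"
    unfolding cprod_def len carrier_tensor_tdim(1)[OF A B] by blast+
qed

lemma ctranspose_L:
  assumes A: "A \<in> carrier_tensor n1 n2 n3"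
  shows "ctranspose A \<in> carrier_tensor n2 n1 n3"
    and "\<And>k. k < n3 \<Longrightarrow> L (ctranspose A) ! k = mat_adjoint (L A ! k)"
proof -
  have len: "length A = n3" using A by (simp add: carrier_tensor_def)
  have "\<exists>!C. C \<in> carrier_tensor n2 n1 n3 \<and> (\<forall>k<n3. L C ! k = mat_adjoint (L A ! k))"
    by (rule L_bij) (intro carrier_matI; simp add: L_nth[OF A])
  from theI'[OF this]
  show "ctranspose A \<in> carrier_tensor n2 n1 n3"
    and "\<And>k. k < n3 \<Longrightarrow> L (ctranspose A) ! k = mat_adjoint (L A ! k)"
    unfolding ctranspose_def len carrier_tensor_tdim(2)[OF A A] by blast+
qed

lemma id_tensor_L: "k < n3 \<Longrightarrow> L (id_tensor n n3) ! k = 1\<^sub>m n"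
  using theI'[OF L_bij[of n3 "\<lambda>_. 1\<^sub>m n" n n]] unfolding id_tensor_def by auto

lemma tensor_eq_iff:
  assumes "A \<in> carrier_tensor n1 n2 n3" "B \<in> carrier_tensor n1 n2 n3"
  shows "A = B \<longleftrightarrow> (\<forall>k<n3. L A ! k = L B ! k)"
  using assms tensor_eqI by auto

text \<open>Each Penrose equation equates two tensors with the same dimensions, so it can be tested on
  the transformed slices, where the tensor operations become matrix operations.\<close>

lemma is_MP_inverse_iff_slices:
  assumes A: "A \<in> carrier_tensor n1 n2 n3"
  shows "is_MP_inverse A X \<longleftrightarrow>
    X \<in> carrier_tensor n2 n1 n3 \<and> (\<forall>k<n3. mat_MP_inverse (L A ! k) (L X ! k))"
proof (cases "X \<in> carrier_tensor n2 n1 n3")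
  case X: True
  have len: "length A = n3" using A by (simp add: carrier_tensor_def)
  note AX = cprod_L[OF A X] and XA = cprod_L[OF X A]
  note AXA = cprod_L[OF AX(1) A] and XAX = cprod_L[OF XA(1) X]
  note AXH = ctranspose_L[OF AX(1)] and XAH = ctranspose_L[OF XA(1)]
  have dims: "L X ! k \<in> carrier_mat (dim_col (L A ! k)) (dim_row (L A ! k))" if "k < n3" for k
    using L_nth_carrier[OF A that] L_nth_carrier[OF X that] by auto
  show ?thesis
    unfolding is_MP_inverse_def len carrier_tensor_tdim(2)[OF A A]
      tensor_eq_iff[OF AXA(1) A] tensor_eq_iff[OF XAX(1) X]
      tensor_eq_iff[OF AXH(1) AX(1)] tensor_eq_iff[OF XAH(1) XA(1)]
    using X dims by (auto simp: mat_MP_inverse_def AX(2) XA(2) AXA(2) XAX(2) AXH(2) XAH(2))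
next
  case False
  moreover have "length A = n3" using A by (simp add: carrier_tensor_def)
  ultimately show ?thesis by (simp add: is_MP_inverse_def carrier_tensor_tdim(2)[OF A A])
qed

text \<open>This is uniqueness of the Moore-Penrose inverse for tensors: any solution of the Penrose
  equations is the one that the definite description denotes.\<close>

lemma MP_inverse_equality:
  assumes A: "A \<in> carrier_tensor n1 n2 n3" and X: "is_MP_inverse A X"
  shows "MP_inverse A = X"
  unfolding MP_inverse_def
proof (rule the_equality)
  show "is_MP_inverse A X" by (rule X)
  fix Y assume "is_MP_inverse A Y"
  with X show "Y = X"
    unfolding is_MP_inverse_iff_slices[OF A] by (auto intro: tensor_eqI mat_MP_inverse_unique)
qed

lemma is_MP_inverse_MP_inverse:
  assumes A: "A \<in> carrier_tensor n1 n2 n3"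
  shows "is_MP_inverse A (MP_inverse A)"
proof -
  define G where "G = (\<lambda>k. SOME X. mat_MP_inverse (L A ! k) X)"
  have G: "mat_MP_inverse (L A ! k) (G k)" for k
    unfolding G_def by (rule someI_ex[OF mat_MP_inverse_exists])
  have Gc: "G k \<in> carrier_mat n2 n1" if "k < n3" for k
    using G[of k] L_nth_carrier[OF A that] by (auto simp: mat_MP_inverse_def)
  from ex1_implies_ex[OF L_bij[of n3 G n2 n1, OF Gc]]
  obtain X where "X \<in> carrier_tensor n2 n1 n3" "\<forall>k<n3. L X ! k = G k" by blast
  with G have "is_MP_inverse A X" by (simp add: is_MP_inverse_iff_slices[OF A])
  with MP_inverse_equality[OF A] show ?thesis by simp
qed

section \<open>The Moore-Penrose inverse from a C-Schur decomposition\<close>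

theorem theorem3p7:
  fixes n n3 :: nat and A Q T :: tensor
  assumes "A \<in> carrier_tensor n n n3"
    and "C_Schur_decomposition n n3 A Q T"
  shows "MP_inverse A = ctranspose Q *\<^sub>c MP_inverse T *\<^sub>c Q"
proof (rule MP_inverse_equality[OF assms(1)])
  have Q: "Q \<in> carrier_tensor n n n3" and T: "T \<in> carrier_tensor n n n3"
    and QQ: "Q *\<^sub>c ctranspose Q = id_tensor n n3" and A: "A = ctranspose Q *\<^sub>c T *\<^sub>c Q"
    using assms(2) by (auto simp: C_Schur_decomposition_def unitary_tensor_def)
  note QH = ctranspose_L[OF Q]
  note QHT = cprod_L[OF QH(1) T]
  note MP = is_MP_inverse_MP_inverse[OF T, unfolded is_MP_inverse_iff_slices[OF T]]
  note QHX = cprod_L[OF QH(1) conjunct1[OF MP]]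
  have UU: "L Q ! k * mat_adjoint (L Q ! k) = 1\<^sub>m n" if "k < n3" for k
    using cprod_L(2)[OF Q QH(1) that] QH(2)[OF that] id_tensor_L[OF that, of n] by (simp add: QQ)
  show "is_MP_inverse A (ctranspose Q *\<^sub>c MP_inverse T *\<^sub>c Q)"
    unfolding is_MP_inverse_iff_slices[OF assms(1)]
  proof (intro conjI allI impI)
    show "ctranspose Q *\<^sub>c MP_inverse T *\<^sub>c Q \<in> carrier_tensor n n n3"
      by (rule cprod_L(1)[OF QHX(1) Q])
    fix k assume k: "k < n3"
    have "mat_MP_inverse (mat_adjoint (L Q ! k) * L T ! k * L Q ! k)
        (mat_adjoint (L Q ! k) * L (MP_inverse T) ! k * L Q ! k)"
      using mat_MP_inverse_unitary_conj[OF L_nth_carrier[OF T k] L_nth_carrier[OF Q k] UU[OF k]]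
        MP k by blast
    then show "mat_MP_inverse (L A ! k) (L (ctranspose Q *\<^sub>c MP_inverse T *\<^sub>c Q) ! k)"
      unfolding A using k
      by (simp add: cprod_L(2)[OF QHT(1) Q] cprod_L(2)[OF QHX(1) Q] QHT(2) QHX(2) QH(2))
  qed
qed

end
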